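(* Consider the removal loop described in the context. Let $S_t$ be the active set at the beginning of iteration $t$ of the removal loop, and let $m=|S_1|$. Assume $D>0$ and that the values $b_i$, $i\in S_1$, are not all equal. Define $$\tau_t=\frac{\sum_{i\in S_t}w_ib_i-D}{\sum_{i\in S_t}w_i}.$$ Let $K\ge1$ be an integer and suppose that, for some integer $s$ with $3\le s\le\lfloor m/K\rfloor$, each of the first $s$ iterations removes at least one and at most $K$ elements, and $\Delta_t=\tau_{t+1}-\tau_t>0$ for $t=1,\ldots,s$. Let $$\xi=\frac{\max_{i\in S_1}w_i}{\min_{i\in S_1}w_i},\qquad \delta=\min_{\substack{i,j\in S_1\\ b_i\ne b_j}}|b_i-b_j|,\qquad L_b=\max_{i\in S_1}b_i-\min_{i\in S_1}b_i.$$ Then $$\delta<L_b\left(1+\frac{K\xi}{m-(s-1)K}\right)\frac{(K\xi)^{s-3}}{\displaystyle\prod_{j=2}^{s-2}(m-jK)},$$ where for $s=3$ the empty product is understood to be $1$.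
   Context: The removal loop is the last phase of a threshold algorithm for minimizing $\sum_{i=1}^n w_ix_i^2$ subject to $\sum_{i=1}^n w_ix_i=c$, $x\le b$, where $w_i>0$, $b_i\in\mathbb R$, and $D=\sum_{i=1}^n w_ib_i-c$. It starts from a nonempty active set $\mathcal S\subseteq\{1,\dots,n\}$, with $W=\sum_{i\in\mathcal S}w_i$ and threshold $\tau$ determined by $\sum_{i\in\mathcal S}w_i(b_i-\tau)=D$. One iteration (pass) of the loop visits every element $i$ of the active set once, in some order; whenever the visited $i$ satisfies $b_i\le\tau$ (with the current $\tau$), the sequential updates $\mathcal S\leftarrow\mathcal S\setminus\{i\}$, $W\leftarrow W-w_i$, $\tau\leftarrow\tau+w_i(\tau-b_i)/W$ are performed. Iterations are repeated until an iteration removes no element. These updates preserve the relation $\sum_{i\in\mathcal S}w_i(b_i-\tau)=D$, so the threshold at the beginning of iteration $t$ equals $\tau_t$. $S_{t+1}$ is the active set after iteration $t$. *)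

theory Defs
  imports Complex_Main
begin

record loop_state =
  active :: "nat set"
  weight :: real
  thresh :: real

text \<open>The updates are sequential, so the new threshold is divided by the already decreased weight.\<close>

definition visit :: "(nat \<Rightarrow> real) \<Rightarrow> (nat \<Rightarrow> real) \<Rightarrow> nat \<Rightarrow> loop_state \<Rightarrow> loop_state" where
  "visit w b i st =
    (if b i \<le> thresh st
     then \<lparr>active = active st - {i},
           weight = weight st - w i,
           thresh = thresh st + w i * (thresh st - b i) / (weight st - w i)\<rparr>
     else st)"

text \<open>The order of the visits is arbitrary, hence a pass is a relation. A visit removes at most
  the visited element, so the elements to be visited are those active at the start of the pass.\<close>

definition removal_pass ::
  "(nat \<Rightarrow> real) \<Rightarrow> (nat \<Rightarrow> real) \<Rightarrow> loop_state \<Rightarrow> loop_state \<Rightarrow> bool" where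
  "removal_pass w b st st' \<longleftrightarrow>
    (\<exists>xs. distinct xs \<and> set xs = active st \<and> st' = fold (visit w b) xs st)"

definition initial_state ::
  "nat \<Rightarrow> (nat \<Rightarrow> real) \<Rightarrow> (nat \<Rightarrow> real) \<Rightarrow> real \<Rightarrow> loop_state \<Rightarrow> bool" where
  "initial_state n w b D st \<longleftrightarrow>
    active st \<noteq> {} \<and> active st \<subseteq> {1..n} \<and>
    weight st = (\<Sum>i\<in>active st. w i) \<and>
    (\<Sum>i\<in>active st. w i * (b i - thresh st)) = D"

text \<open>A complete execution with \<open>T\<close> iterations: iteration \<open>t\<close> leads from \<open>st t\<close> to \<open>st (t + 1)\<close>,
  and iteration \<open>T\<close> is the first one that removes nothing. Values of \<open>st\<close> outside
  \<open>{1..T + 1}\<close> are irrelevant.\<close>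

definition removal_loop ::
  "nat \<Rightarrow> (nat \<Rightarrow> real) \<Rightarrow> (nat \<Rightarrow> real) \<Rightarrow> real \<Rightarrow> nat \<Rightarrow> (nat \<Rightarrow> loop_state) \<Rightarrow> bool" where
  "removal_loop n w b D T st \<longleftrightarrow>
    1 \<le> T \<and> initial_state n w b D (st 1) \<and>
    (\<forall>t\<in>{1..T}. removal_pass w b (st t) (st (t + 1))) \<and>
    (\<forall>t\<in>{1..<T}. active (st (t + 1)) \<noteq> active (st t)) \<and>
    active (st (T + 1)) = active (st T)"

end

theory Submission
  imports Defs
begin

text \<open>An element removed in iteration \<open>t \<ge> 2\<close> survived iteration \<open>t - 1\<close>, so its \<open>b\<close>-value exceeds
  \<open>\<tau> (t - 1)\<close>, and conservation of \<open>D\<close> gives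
  \<open>\<Delta> t * W (t + 1) = (\<Sum>i removed. w i * (\<tau> t - b i)) \<le> \<Delta> (t - 1) * (\<Sum>i removed. w i)\<close>.
  Hence \<open>\<Delta> t \<le> K \<xi> / (m - t K) * \<Delta> (t - 1)\<close>, while \<open>\<Delta> 1 \<le> Lb\<close>. As \<open>\<Delta> (s - 1)\<close> and \<open>\<Delta> s\<close> are
  positive, iterations \<open>s - 1\<close> and \<open>s\<close> each remove a value below the threshold they start with;
  these two values lie in \<open>(\<tau> (s - 2), \<tau> (s - 1))\<close> and \<open>(\<tau> (s - 1), \<tau> s)\<close>, so they are distinct and
  less than \<open>\<Delta> (s - 2) + \<Delta> (s - 1)\<close> apart.\<close>

text \<open>The invariant is stated for any state, including those in the middle of a pass, since
  each visit may change weight and threshold. Finiteness and positive weights are carried along so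
  that the lemmas below need no reference to \<open>{1..n}\<close>.\<close>

definition balanced :: "(nat \<Rightarrow> real) \<Rightarrow> (nat \<Rightarrow> real) \<Rightarrow> real \<Rightarrow> loop_state \<Rightarrow> bool" where
  "balanced w b D st \<longleftrightarrow>
    finite (active st) \<and> (\<forall>i\<in>active st. 0 < w i) \<and>
    weight st = (\<Sum>i\<in>active st. w i) \<and>
    (\<Sum>i\<in>active st. w i * (b i - thresh st)) = D"

section \<open>Conservation law at a single state and under visits\<close>

lemma balanced_nonempty:
  assumes "balanced w b D st" "D > 0"
  shows "active st \<noteq> {}"
  using assms by (auto simp: balanced_def)

lemma balanced_weight_pos:
  assumes "balanced w b D st" "D > 0"
  shows "0 < (\<Sum>i\<in>active st. w i)"
  using assms balanced_nonempty[OF assms] by (auto simp: balanced_def intro!: sum_pos)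

text \<open>Otherwise every term of the conserved sum would be nonpositive, against
  \<open>D > 0\<close>. This keeps a visit from emptying the active set, so the division in
  \<open>visit\<close> is never by zero.\<close>

lemma balanced_thresh_less:
  assumes "balanced w b D st" "D > 0"
  shows "\<exists>i\<in>active st. thresh st < b i"
proof (rule ccontr)
  assume "\<not> ?thesis"
  then have "(\<Sum>i\<in>active st. w i * (b i - thresh st)) \<le> 0"
    using assms by (intro sum_nonpos) (auto simp: balanced_def not_less mult_le_0_iff dest: less_imp_le)
  then show False
    using assms by (simp add: balanced_def)
qed

lemma balanced_thresh_eq:
  assumes "balanced w b D st" "D > 0"
  shows "thresh st = ((\<Sum>i\<in>active st. w i * b i) - D) / (\<Sum>i\<in>active st. w i)"
proof -
  have "(\<Sum>i\<in>active st. w i * b i) - thresh st * (\<Sum>i\<in>active st. w i) = D"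
    using assms(1) by (simp add: balanced_def right_diff_distrib sum_subtractf sum_distrib_left mult.commute)
  then show ?thesis
    using balanced_weight_pos[OF assms] by (simp add: field_simps)
qed

text \<open>With \<open>x\<close> the old threshold, dropping \<open>i\<close> raises the remaining
  sum by \<open>w i * (x - b i)\<close>. The new threshold lowers it by its increase times the
  remaining weight \<open>W\<close>, which is the same amount.\<close>

lemma balanced_visit:
  assumes bal: "balanced w b D st" and D: "D > 0" and i: "i \<in> active st"
  shows "balanced w b D (visit w b i st)" "thresh st \<le> thresh (visit w b i st)"
proof -
  have "balanced w b D (visit w b i st) \<and> thresh st \<le> thresh (visit w b i st)"
  proof (cases "b i \<le> thresh st")
    case True
    define A where "A = active st - {i}"
    define x where "x = thresh st"
    define W where "W = (\<Sum>j\<in>A. w j)"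
    have fin: "finite (active st)" and pos: "\<And>j. j \<in> active st \<Longrightarrow> 0 < w j"
      and wt: "weight st = (\<Sum>j\<in>active st. w j)"
      and D_eq: "(\<Sum>j\<in>active st. w j * (b j - x)) = D"
      using bal by (auto simp: balanced_def x_def)
    have wt': "weight st - w i = W"
      using wt sum.remove[OF fin i, of w] by (simp add: A_def W_def)
    \<comment> \<open>The removed \<open>i\<close> is not above the threshold, while some active
      element is.\<close>
    have "A \<noteq> {}"
      using balanced_thresh_less[OF bal D] True by (auto simp: A_def)
    then have Wpos: "0 < W"
      unfolding W_def using fin pos by (intro sum_pos) (auto simp: A_def)
    define y where "y = x + w i * (x - b i) / W"
    have vis: "visit w b i st = \<lparr>active = A, weight = W, thresh = y\<rparr>"
      using True wt' by (simp add: visit_def A_def y_def x_def)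
    have "(\<Sum>j\<in>A. w j * (b j - y)) = (\<Sum>j\<in>A. w j * (b j - x)) - (y - x) * W"
      by (simp add: W_def algebra_simps sum_subtractf sum.distrib sum_distrib_left)
    also have "(y - x) * W = w i * (x - b i)"
      using Wpos by (simp add: y_def)
    also have "(\<Sum>j\<in>A. w j * (b j - x)) - w i * (x - b i) = D"
      using D_eq sum.remove[OF fin i, of "\<lambda>j. w j * (b j - x)"]
      by (simp add: A_def algebra_simps)
    finally have "(\<Sum>j\<in>A. w j * (b j - y)) = D" .
    moreover have "x \<le> y"
      using Wpos True pos[OF i] by (simp add: y_def x_def)
    ultimately show ?thesis
      using fin pos unfolding vis by (auto simp: balanced_def A_def W_def x_def)
  qed (use bal in \<open>simp add: visit_def\<close>)
  then show "balanced w b D (visit w b i st)" "thresh st \<le> thresh (visit w b i st)"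
    by auto
qed

text \<open>The threshold never falls during a pass, so an element that survives its own visit
  exceeds the starting threshold as well. Letting \<open>xs\<close> list only a part of the active
  set makes the induction work: elements kept earlier are active but no longer to be
  visited.\<close>

lemma balanced_fold_visit:
  assumes "balanced w b D st" "D > 0" "distinct xs" "set xs \<subseteq> active st"
  shows "balanced w b D (fold (visit w b) xs st) \<and>
    thresh st \<le> thresh (fold (visit w b) xs st) \<and>
    active (fold (visit w b) xs st) \<subseteq> active st \<and>
    (\<forall>i\<in>set xs \<inter> active (fold (visit w b) xs st). thresh st < b i)"
  using assms
proof (induction xs arbitrary: st)
  case (Cons i xs)
  define st' where "st' = visit w b i st"
  have i: "i \<in> active st"
    using Cons.prems by simp
  note vis = balanced_visit[OF Cons.prems(1,2) i, folded st'_def]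
  have sub: "set xs \<subseteq> active st'"
    using Cons.prems by (auto simp: st'_def visit_def)
  have step: "active st' \<subseteq> active st" "i \<in> active st' \<Longrightarrow> thresh st < b i"
    by (auto simp: st'_def visit_def split: if_splits)
  have fold_eq: "fold (visit w b) (i # xs) st = fold (visit w b) xs st'"
    by (simp add: st'_def)
  have "distinct xs"
    using Cons.prems by simp
  then have IH: "balanced w b D (fold (visit w b) xs st')"
    "thresh st' \<le> thresh (fold (visit w b) xs st')"
    "active (fold (visit w b) xs st') \<subseteq> active st'"
    "\<forall>j\<in>set xs \<inter> active (fold (visit w b) xs st'). thresh st' < b j"
    using Cons.IH[OF vis(1) Cons.prems(2) _ sub] by blast+
  have "\<forall>j\<in>set (i # xs) \<inter> active (fold (visit w b) xs st'). thresh st < b j"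
    using IH(3,4) step(2) vis(2) by (auto intro: le_less_trans)
  then show ?case
    unfolding fold_eq using IH(1-3) step(1) vis(2) by auto
qed simp

lemma balanced_removal_pass:
  assumes "balanced w b D st" "D > 0" "removal_pass w b st st'"
  shows "balanced w b D st'" "thresh st \<le> thresh st'" "active st' \<subseteq> active st"
    "\<And>i. i \<in> active st' \<Longrightarrow> thresh st < b i"
proof -
  obtain xs where xs: "distinct xs" "set xs = active st" "st' = fold (visit w b) xs st"
    using assms(3) by (auto simp: removal_pass_def)
  note f = balanced_fold_visit[OF assms(1,2) xs(1), folded xs(3)]
  show "balanced w b D st'" "thresh st \<le> thresh st'" "active st' \<subseteq> active st"
    "\<And>i. i \<in> active st' \<Longrightarrow> thresh st < b i"
    using f xs(2) by auto
qed

section \<open>Threshold increments over a whole pass\<close>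

lemma balanced_increment:
  assumes bal: "balanced w b D st" and bal': "balanced w b D st'"
    and sub: "active st' \<subseteq> active st"
  shows "(thresh st' - thresh st) * (\<Sum>i\<in>active st'. w i) =
    (\<Sum>i\<in>active st - active st'. w i * (thresh st - b i))"
proof -
  let ?A = "active st" and ?A' = "active st'" and ?x = "thresh st" and ?y = "thresh st'"
  have fin: "finite ?A" and D: "(\<Sum>i\<in>?A. w i * (b i - ?x)) = D"
    and D': "(\<Sum>i\<in>?A'. w i * (b i - ?y)) = D"
    using bal bal' by (auto simp: balanced_def)
  \<comment> \<open>Only the two end states are compared, so the order of the visits and the
    intermediate thresholds drop out.\<close>
  have "(?y - ?x) * (\<Sum>i\<in>?A'. w i) =
      (\<Sum>i\<in>?A'. w i * (b i - ?x)) - (\<Sum>i\<in>?A'. w i * (b i - ?y))"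
    by (simp add: algebra_simps sum_subtractf sum.distrib sum_distrib_left)
  also have "\<dots> = - (\<Sum>i\<in>?A - ?A'. w i * (b i - ?x))"
    using D D' sum.subset_diff[OF sub fin, of "\<lambda>i. w i * (b i - ?x)"] by linarith
  also have "\<dots> = (\<Sum>i\<in>?A - ?A'. w i * (?x - b i))"
    by (simp add: sum_negf[symmetric] algebra_simps)
  finally show ?thesis .
qed

text \<open>Elements equal to the old threshold can be removed too, and larger ones once the
  threshold has risen within the pass. If all removed elements were of these kinds, the right side
  of \<open>balanced_increment\<close> would be nonpositive.\<close>

lemma balanced_increment_pos:
  assumes "balanced w b D st" "balanced w b D st'" "D > 0"
    and "active st' \<subseteq> active st" "thresh st < thresh st'"
  shows "\<exists>i\<in>active st - active st'. b i < thresh st"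
proof (rule ccontr)
  assume "\<not> ?thesis"
  then have "(\<Sum>i\<in>active st - active st'. w i * (thresh st - b i)) \<le> 0"
    using assms(1)
    by (intro sum_nonpos) (auto simp: balanced_def not_less mult_le_0_iff dest: less_imp_le)
  moreover have "0 < (thresh st' - thresh st) * (\<Sum>i\<in>active st'. w i)"
    using assms balanced_weight_pos[of w b D st'] by simp
  ultimately show False
    using balanced_increment[OF assms(1,2,4)] by simp
qed

text \<open>In \<open>balanced_increment\<close>, at most \<open>k\<close> removed elements
  contribute at most \<open>hi * d\<close> each, while the remaining weight is at least
  \<open>r * lo\<close>. The real bound \<open>r\<close> stands in for the cardinality so that
  \<open>m - t * K\<close> can be inserted.\<close>

lemma balanced_increment_le:
  assumes bal: "balanced w b D st" and bal': "balanced w b D st'"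
    and sub: "active st' \<subseteq> active st"
    and removed: "\<And>i. i \<in> active st - active st' \<Longrightarrow> thresh st - b i \<le> d" and d: "0 \<le> d"
    and w_bounds: "\<And>i. i \<in> active st \<Longrightarrow> lo \<le> w i" "\<And>i. i \<in> active st \<Longrightarrow> w i \<le> hi"
      "0 < lo" "0 \<le> hi"
    and k: "real (card (active st - active st')) \<le> k"
    and r: "0 < r" "r \<le> real (card (active st'))"
    and mono: "thresh st \<le> thresh st'"
  shows "thresh st' - thresh st \<le> k * (hi / lo) / r * d"
proof -
  let ?R = "active st - active st'"
  have "(thresh st' - thresh st) * (r * lo) \<le>
      (thresh st' - thresh st) * (\<Sum>i\<in>active st'. w i)"
  proof (rule mult_left_mono)
    have "r * lo \<le> real (card (active st')) * lo"
      using r w_bounds by simp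
    also have "\<dots> \<le> (\<Sum>i\<in>active st'. w i)"
      using w_bounds sub by (intro sum_bounded_below) auto
    finally show "r * lo \<le> (\<Sum>i\<in>active st'. w i)" .
  qed (use mono in simp)
  also have "\<dots> = (\<Sum>i\<in>?R. w i * (thresh st - b i))"
    by (rule balanced_increment[OF bal bal' sub])
  also have "\<dots> \<le> (\<Sum>i\<in>?R. hi * d)"
  proof (rule sum_mono)
    fix i assume i: "i \<in> ?R"
    have "w i * (thresh st - b i) \<le> w i * d"
      using removed[OF i] w_bounds(1)[of i] w_bounds(3) i by (intro mult_left_mono) auto
    also have "\<dots> \<le> hi * d"
      using i w_bounds(2) d by (intro mult_right_mono) auto
    finally show "w i * (thresh st - b i) \<le> hi * d" .
  qed
  also have "\<dots> \<le> k * (hi * d)"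
    using k w_bounds d by (auto intro: mult_right_mono)
  finally show ?thesis
    using r w_bounds by (simp add: field_simps)
qed

theorem theorem8:
  fixes n T K s m :: nat
    and w b \<tau> \<Delta> :: "nat \<Rightarrow> real"
    and c D \<xi> \<delta> Lb :: real
    and st :: "nat \<Rightarrow> loop_state"
    and S :: "nat \<Rightarrow> nat set"
  assumes w_pos: "\<And>i. i \<in> {1..n} \<Longrightarrow> w i > 0"
    and D_def: "D = (\<Sum>i=1..n. w i * b i) - c"
    and D_pos: "D > 0"
    and loop: "removal_loop n w b D T st"
    and S_def: "\<And>t. S t = active (st t)"
    and m_def: "m = card (S 1)"
    and not_all_equal: "\<exists>i\<in>S 1. \<exists>j\<in>S 1. b i \<noteq> b j"
    and tau_def: "\<And>t. \<tau> t = ((\<Sum>i\<in>S t. w i * b i) - D) / (\<Sum>i\<in>S t. w i)"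
    and Delta_def: "\<And>t. \<Delta> t = \<tau> (t + 1) - \<tau> t"
    and K_ge: "K \<ge> 1"
    and s_ge: "3 \<le> s"
    and s_le: "s \<le> m div K"
    and s_iterations: "s \<le> T"
    and removed: "\<And>t. t \<in> {1..s} \<Longrightarrow>
      1 \<le> card (S t - S (t + 1)) \<and> card (S t - S (t + 1)) \<le> K"
    and Delta_pos: "\<And>t. t \<in> {1..s} \<Longrightarrow> \<Delta> t > 0"
    and xi_def: "\<xi> = Max (w ` S 1) / Min (w ` S 1)"
    and delta_def: "\<delta> = Min {\<bar>b i - b j\<bar> | i j. i \<in> S 1 \<and> j \<in> S 1 \<and> b i \<noteq> b j}"
    and Lb_def: "Lb = Max (b ` S 1) - Min (b ` S 1)"
  shows "\<delta> < Lb * (1 + real K * \<xi> / (real m - (real s - 1) * real K))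
              * ((real K * \<xi>) ^ (s - 3) / (\<Prod>j=2..s-2. (real m - real j * real K)))"
proof -

  \<comment> \<open>Invariant and cardinalities along the iterations\<close>
  have steps: "removal_pass w b (st t) (st (t + 1))" if "t \<in> {1..s}" for t
    using loop s_iterations that by (auto simp: removal_loop_def)
  have init: "initial_state n w b D (st 1)"
    using loop by (simp add: removal_loop_def)
  have fin: "finite (S 1)"
    using init finite_subset by (auto simp: initial_state_def S_def)
  have w_pos1: "0 < w i" if "i \<in> S 1" for i
    using init that w_pos by (auto simp: initial_state_def S_def)
  have bal1: "balanced w b D (st 1)"
    using init fin w_pos1 by (auto simp: initial_state_def balanced_def S_def)
  have bal: "balanced w b D (st t)" if "t \<in> {1..s + 1}" for t
  proof -
    have "1 \<le> t" using that by simp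
    then show ?thesis using that
    proof (induction t rule: dec_induct)
      case (step t)
      then show ?case
        using balanced_removal_pass(1)[OF _ D_pos steps[of t]] by simp
    qed (rule bal1)
  qed
  have thresh_eq: "thresh (st t) = \<tau> t" if "t \<in> {1..s + 1}" for t
    using balanced_thresh_eq[OF bal[OF that] D_pos] by (simp add: tau_def S_def)
  note pass = balanced_removal_pass[OF bal D_pos steps]
  have survive: "\<tau> t < b i" if "t \<in> {1..s}" "i \<in> S (t + 1)" for t i
    using pass(4)[of t i] that thresh_eq[of t] by (simp add: S_def)
  have S_step: "S (t + 1) \<subseteq> S t" if "t \<in> {1..s}" for t
    using pass(3)[of t] that by (simp add: S_def)
  have below: "\<exists>i\<in>S t - S (t + 1). b i < \<tau> t" if "t \<in> {1..s}" for t
    using balanced_increment_pos[OF bal bal D_pos pass(3), of t] that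
      Delta_pos[OF that] thresh_eq[of t] thresh_eq[of "t + 1"]
    by (simp add: Delta_def S_def)
  \<comment> \<open>Each of the \<open>t - 1\<close> earlier iterations removes at most
    \<open>K\<close> elements; the additive form avoids a truncated
    \<open>m - (t - 1) * K\<close>.\<close>
  have S_card: "S t \<subseteq> S 1 \<and> m \<le> card (S t) + (t - 1) * K" if "t \<in> {1..s + 1}" for t
  proof -
    have "1 \<le> t" using that by simp
    then show ?thesis using that
    proof (induction t rule: dec_induct)
      case base
      then show ?case by (simp add: m_def)
    next
      case (step t)
      have t: "t \<in> {1..s}" using step by simp
      then have IH: "S t \<subseteq> S 1" "m \<le> card (S t) + (t - 1) * K"
        using step by auto
      have "finite (S t)"
        using IH(1) fin finite_subset by blast
      then have "card (S t) = card (S (t + 1)) + card (S t - S (t + 1))"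
        using S_step[OF t] by (metis card_Diff_subset card_mono finite_subset le_add_diff_inverse)
      then have "card (S t) \<le> card (S (t + 1)) + K"
        using removed[OF t] by simp
      moreover have "t * K = (t - 1) * K + K"
        using t by (cases t) auto
      ultimately show ?case
        using IH S_step[OF t] by auto
    qed
  qed
  have S_sub: "S t \<subseteq> S 1" if "t \<in> {1..s + 1}" for t
    using S_card[OF that] by simp
  have sK: "s * K \<le> m"
    using s_le by (meson div_times_less_eq_dividend le_trans mult_le_mono1)
  have den_pos: "0 < real m - real t * real K" if "t < s" for t
  proof -
    have "t * K < s * K" using that K_ge by simp
    then have "t * K < m" using sK by (rule less_le_trans)
    then have "real (t * K) < real m" by (simp only: of_nat_less_iff)
    then show ?thesis by simp
  qed

  \<comment> \<open>Weight ratio and decay of the increments\<close>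
  have ne: "S 1 \<noteq> {}"
    using not_all_equal by auto
  have Min_pos: "0 < Min (w ` S 1)"
    using fin ne w_pos1 by simp
  have w_ge: "Min (w ` S 1) \<le> w i" and w_le: "w i \<le> Max (w ` S 1)" if "i \<in> S 1" for i
    using fin that by auto
  have Max_pos: "0 < Max (w ` S 1)"
    using ne w_le w_pos1 by (meson ex_in_conv less_le_trans)
  have xi_pos: "0 < \<xi>"
    using Min_pos Max_pos by (simp add: xi_def)
  \<comment> \<open>Here \<open>2 \<le> t\<close> supplies a previous iteration and
    \<open>t < s\<close> a positive denominator.\<close>
  have ratio: "\<Delta> t \<le> real K * \<xi> / (real m - real t * real K) * \<Delta> (t - 1)"
    if t: "2 \<le> t" "t < s" for t
  proof -
    have "m \<le> card (S (t + 1)) + t * K"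
      using S_card[of "t + 1"] t by simp
    then have "real m \<le> real (card (S (t + 1)) + t * K)"
      by (simp only: of_nat_le_iff)
    then have card': "real m - real t * real K \<le> real (card (S (t + 1)))"
      by simp
    have St: "S t \<subseteq> S 1" using S_sub t by simp
    have prev: "\<tau> t - b i \<le> \<Delta> (t - 1)" if "i \<in> S t" for i
      using survive[of "t - 1" i] that t by (force simp: Delta_def)
    have "thresh (st (t + 1)) - thresh (st t) \<le>
        real K * (Max (w ` S 1) / Min (w ` S 1)) / (real m - real t * real K) * \<Delta> (t - 1)"
    proof (rule balanced_increment_le[OF bal bal pass(3) _ _ _ _ Min_pos])
      show "thresh (st t) - b i \<le> \<Delta> (t - 1)" if "i \<in> active (st t) - active (st (t + 1))" for i
        using prev[of i] that thresh_eq[of t] t by (simp add: S_def)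
      show "0 \<le> \<Delta> (t - 1)"
        using Delta_pos[of "t - 1"] t by force
      show "Min (w ` S 1) \<le> w i" "w i \<le> Max (w ` S 1)" if "i \<in> active (st t)" for i
        using w_ge w_le St that by (auto simp: S_def)
      show "real (card (active (st t) - active (st (t + 1)))) \<le> real K"
        using removed[of t] t by (simp add: S_def)
      show "real m - real t * real K \<le> real (card (active (st (t + 1))))"
        using card' by (simp add: S_def)
      show "thresh (st t) \<le> thresh (st (t + 1))"
        using pass(2)[of t] t by simp
    qed (use t den_pos Max_pos in auto)
    then show ?thesis
      using thresh_eq[of t] thresh_eq[of "t + 1"] t by (simp add: Delta_def xi_def)
  qed
  \<comment> \<open>Iteration 1 has no predecessor to compare with. Instead, \<open>\<tau> 1\<close>
    lies above the value of an element it removes, and \<open>\<tau> 2\<close> lies below the value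
    of an element still active, by \<open>balanced_thresh_less\<close>.\<close>
  have Delta_1: "\<Delta> 1 \<le> Lb"
  proof -
    obtain i where i: "i \<in> S 1" "b i < \<tau> 1"
      using below[of 1] s_ge by auto
    obtain j where j: "j \<in> S 2" "\<tau> 2 < b j"
      using balanced_thresh_less[OF bal D_pos, of 2] thresh_eq[of 2] s_ge by (auto simp: S_def)
    have "j \<in> S 1" using j S_sub[of 2] s_ge by auto
    then have "b j \<le> Max (b ` S 1)" using fin by simp
    moreover have "Min (b ` S 1) \<le> b i" using fin i by simp
    ultimately show ?thesis
      using i j by (simp add: Delta_def Lb_def numeral_2_eq_2)
  qed
  \<comment> \<open>The shift by one starts the induction at \<open>\<Delta> 1\<close> with an empty
    product; passing from \<open>r\<close> to \<open>Suc r\<close> adds the factor of iteration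
    \<open>r + 2\<close>.\<close>
  have decay: "\<Delta> (r + 1) \<le>
      Lb * ((real K * \<xi>) ^ r / (\<Prod>j=2..r + 1. (real m - real j * real K)))"
    if "r + 1 < s" for r
    using that
  proof (induction r)
    case 0
    then show ?case using Delta_1 by simp
  next
    case (Suc r)
    define q where "q = real K * \<xi> / (real m - real (r + 2) * real K)"
    have "0 \<le> q"
      unfolding q_def using den_pos[of "r + 2"] Suc.prems xi_pos by simp
    have "\<Delta> (r + 2) \<le> q * \<Delta> (r + 1)"
      using ratio[of "r + 2"] Suc.prems by (simp add: q_def)
    also have "\<dots> \<le> q * (Lb * ((real K * \<xi>) ^ r / (\<Prod>j=2..r + 1. (real m - real j * real K))))"
      using Suc \<open>0 \<le> q\<close> by (intro mult_left_mono) auto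
    also have "\<dots> = Lb * ((real K * \<xi>) ^ Suc r / (\<Prod>j=2..Suc r + 1. (real m - real j * real K)))"
      by (simp add: q_def mult.commute mult.left_commute)
    finally show ?case by simp
  qed

  \<comment> \<open>Two distinct values close together\<close>
  have idx: "s - 1 \<in> {1..s}" "s - 2 \<in> {1..s}" "s - 1 + 1 = s" "s - 2 + 1 = s - 1"
    using s_ge by auto
  obtain i where i: "i \<in> S (s - 1)" "b i < \<tau> (s - 1)"
    using below[OF idx(1)] by blast
  \<comment> \<open>The increment \<open>\<Delta> s\<close> itself never enters the bound; its
    positivity provides this element.\<close>
  obtain j where j: "j \<in> S s" "b j < \<tau> s"
    using below[of s] s_ge by auto
  have i': "\<tau> (s - 2) < b i"
    using survive[OF idx(2), of i] i(1) by (simp only: idx)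
  have j': "\<tau> (s - 1) < b j"
    using survive[OF idx(1), of j] j(1) by (simp only: idx)
  have ij: "i \<in> S 1" "j \<in> S 1"
    using i(1) j(1) S_sub[of s] S_sub[of "s - 1"] idx(1) by force+
  \<comment> \<open>Finiteness of the set of gaps is what makes its \<open>Min\<close> a lower
    bound.\<close>
  have "finite ((\<lambda>(i, j). \<bar>b i - b j\<bar>) ` (S 1 \<times> S 1))"
    using fin by simp
  then have "finite {\<bar>b i - b j\<bar> | i j. i \<in> S 1 \<and> j \<in> S 1 \<and> b i \<noteq> b j}"
    by (rule finite_subset[rotated]) auto
  moreover have "b i \<noteq> b j"
    using i j' by simp
  ultimately have "\<delta> \<le> \<bar>b i - b j\<bar>"
    unfolding delta_def using ij by (intro Min_le) blast+
  also have "\<dots> < \<tau> s - \<tau> (s - 2)"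
    using i i' j j' by simp
  also have "\<dots> = \<Delta> (s - 2) + \<Delta> (s - 1)"
    by (simp add: Delta_def idx del: One_nat_def)
  \<comment> \<open>Using \<open>ratio\<close> at \<open>s - 1\<close> splits off this factor, so
    \<open>decay\<close> is needed only for \<open>\<Delta> (s - 2)\<close>, that is at
    \<open>r = s - 3\<close>, and the product stops at \<open>s - 2\<close>.\<close>
  also have "\<dots> \<le> (1 + real K * \<xi> / (real m - (real s - 1) * real K)) * \<Delta> (s - 2)"
    using ratio[of "s - 1"] s_ge by (simp add: algebra_simps of_nat_diff numeral_2_eq_2)
  also have "\<dots> \<le> (1 + real K * \<xi> / (real m - (real s - 1) * real K)) *
      (Lb * ((real K * \<xi>) ^ (s - 3) / (\<Prod>j=2..s-2. (real m - real j * real K))))"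
  proof (rule mult_left_mono)
    have "s - 3 + 1 = s - 2" using s_ge by simp
    then show "\<Delta> (s - 2) \<le>
        Lb * ((real K * \<xi>) ^ (s - 3) / (\<Prod>j=2..s-2. (real m - real j * real K)))"
      using decay[of "s - 3"] s_ge by simp
    have "0 < real m - (real s - 1) * real K"
      using den_pos[of "s - 1"] s_ge by (simp add: of_nat_diff)
    then show "0 \<le> 1 + real K * \<xi> / (real m - (real s - 1) * real K)"
      using xi_pos by simp
  qed
  finally show ?thesis
    by (simp only: mult.assoc mult.left_commute)
qed

end
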